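(* Let $a, b, c$ be pairwise relatively prime positive integers, let $\mathcal{T}\subseteq\mathbb{R}^3$ be the convex hull of $(a,0,0)$, $(0,b,0)$, $(0,0,c)$ and $(0,0,0)$, and let $t$ be a positive integer. Then \begin{align*} &(u-1)(v-1)(w-1) \left( u^a - v^b \right) \left( u^a - w^c \right) \left( v^b - w^c \right) \sigma_{t \mathcal{T}} (u,v,w) \\ &\quad = u^{(t+2)a} (v-1)(w-1) \left( v^b - w^c \right) \left( (u-1) + \mathrm{drc}\left( u^{-1},v,w;a,b,c \right) \right) \\ &\qquad - v^{(t+2)b} (u-1)(w-1) \left( u^a - w^c \right) \left( (v-1) + \mathrm{drc}\left( v^{-1},u,w;b,a,c \right) \right) \\ &\qquad + w^{(t+2)c} (u-1)(v-1) \left( u^a - v^b \right) \left( (w-1) + \mathrm{drc}\left( w^{-1},u,v;c,a,b \right) \right) \\ &\qquad - \left( u^a - v^b \right) \left( u^a - w^c \right) \left( v^b - w^c \right). \end{align*}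
   Context: For a polytope $\mathcal{P}\subseteq\mathbb{R}^3$, its integer-point transform is $\sigma_{\mathcal{P}}(u,v,w) := \sum_{(m_1,m_2,m_3) \in \mathcal{P}\cap\mathbb{Z}^3} u^{m_1} v^{m_2} w^{m_3}$, and $t\mathcal{T}$ denotes the dilate $\{t\boldsymbol{x}:\boldsymbol{x}\in\mathcal{T}\}$. For positive integers $a,b,c$ and indeterminates $u,v,w$, the Dedekind--Rademacher--Carlitz sum is \[ \mathrm{drc}(u,v,w;a,b,c) := \sum_{k=0}^{c-1} \sum_{j=0}^{b-1} u^{\lfloor ja/b + ka/c\rfloor} v^j w^k , \] where the first argument may be replaced by $u^{-1}$ etc. *)

theory Defs
  imports "HOL-Analysis.Analysis" "HOL-Library.Poly_Mapping"
begin

(* The group ring of int x int x int over 'k, i.e. the ring of Laurent polynomials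
   k[u, 1/u, v, 1/v, w, 1/w]: the additive structure on the exponents makes the
   convolution product of Poly_Mapping the product of Laurent polynomials. *)
type_synonym 'k laurent3 = "(int \<times> int \<times> int) \<Rightarrow>\<^sub>0 'k"

(* u^i v^j w^l *)
definition laurent_monomial :: "int \<Rightarrow> int \<Rightarrow> int \<Rightarrow> 'k::comm_ring_1 laurent3" where
  "laurent_monomial i j l = Poly_Mapping.single (i, j, l) 1"

lemma laurent_monomial_0: "laurent_monomial 0 0 0 = 1"
  by (simp add: laurent_monomial_def single_one flip: zero_prod_def)

lemma laurent_monomial_mult:
  "laurent_monomial i j l * laurent_monomial i' j' l' = laurent_monomial (i + i') (j + j') (l + l')"
  by (simp add: laurent_monomial_def mult_single)

lemma laurent_monomial_power:
  "laurent_monomial i j l ^ n = laurent_monomial (int n * i) (int n * j) (int n * l)"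
  by (induction n) (simp_all add: laurent_monomial_0 laurent_monomial_mult algebra_simps)

definition lattice_points :: "(real ^ 3) set \<Rightarrow> (int \<times> int \<times> int) set" where
  "lattice_points P = {(m1, m2, m3). vector [of_int m1, of_int m2, of_int m3] \<in> P}"

(* Meaningful for bounded P only: the sum over an infinite set is 0 by convention. *)
definition integer_point_transform :: "(real ^ 3) set \<Rightarrow> 'k::comm_ring_1 laurent3" where
  "integer_point_transform P = (\<Sum>(m1, m2, m3)\<in>lattice_points P. laurent_monomial m1 m2 m3)"

lemma finite_lattice_points:
  assumes "bounded P"
  shows "finite (lattice_points P)"
proof -
  obtain B where B: "\<And>x. x \<in> P \<Longrightarrow> norm x \<le> B"
    using assms by (auto simp: bounded_iff)
  have "lattice_points P \<subseteq> {-\<lceil>B\<rceil>..\<lceil>B\<rceil>} \<times> {-\<lceil>B\<rceil>..\<lceil>B\<rceil>} \<times> {-\<lceil>B\<rceil>..\<lceil>B\<rceil>}"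
  proof
    fix m assume "m \<in> lattice_points P"
    then obtain m1 m2 m3 where m: "m = (m1, m2, m3)"
      and "vector [of_int m1, of_int m2, of_int m3] \<in> P"
      by (auto simp: lattice_points_def)
    then have "\<bar>(vector [of_int m1, of_int m2, of_int m3] :: real ^ 3) $ i\<bar> \<le> B" for i
      using B component_le_norm_cart order_trans by blast
    from this[of 1] this[of 2] this[of 3]
    have "\<bar>of_int m1\<bar> \<le> B" "\<bar>of_int m2\<bar> \<le> B" "\<bar>of_int m3\<bar> \<le> B"
      by (simp_all add: vector_3)
    then have "\<bar>m1\<bar> \<le> \<lceil>B\<rceil>" "\<bar>m2\<bar> \<le> \<lceil>B\<rceil>" "\<bar>m3\<bar> \<le> \<lceil>B\<rceil>"
      by linarith+
    then show "m \<in> {-\<lceil>B\<rceil>..\<lceil>B\<rceil>} \<times> {-\<lceil>B\<rceil>..\<lceil>B\<rceil>} \<times> {-\<lceil>B\<rceil>..\<lceil>B\<rceil>}"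
      by (auto simp: m)
  qed
  then show ?thesis
    by (rule finite_subset) simp
qed

(* The arguments x, y, z are elements of an arbitrary commutative ring, so that inverses of
   indeterminates can be substituted. The floor is non-negative, hence nat loses nothing. *)
definition drc :: "'r::comm_ring_1 \<Rightarrow> 'r \<Rightarrow> 'r \<Rightarrow> nat \<Rightarrow> nat \<Rightarrow> nat \<Rightarrow> 'r" where
  "drc x y z a b c =
     (\<Sum>k<c. \<Sum>j<b. x ^ nat \<lfloor>real (j * a) / real b + real (k * a) / real c\<rfloor> * y ^ j * z ^ k)"

definition corner_tetrahedron :: "nat \<Rightarrow> nat \<Rightarrow> nat \<Rightarrow> (real ^ 3) set" where
  "corner_tetrahedron a b c =
     convex hull {vector [real a, 0, 0], vector [0, real b, 0], vector [0, 0, real c], 0}"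

end

theory Submission imports Defs begin

text \<open>Laurent polynomials act by convolution on arbitrary functions on the lattice, which makes sense
  of generating functions of unbounded cones without dividing. Order the vertices of the tetrahedron
  and flip the rays of the tangent cones to point in one direction (Lawrence--Varchenko): the indicator
  function of the tetrahedron becomes a signed sum of four indicator functions of half-open cones, an
  identity that holds pointwise rather than modulo lines. Convolving such a cone with the binomials of
  its three rays telescopes to the lattice points of a half-open parallelepiped, and these are counted
  by the Dedekind--Rademacher--Carlitz sum; coprimality enters because the floor function must
  see a nonintegral argument everywhere except at the origin.\<close>

section \<open>Convolution action of Laurent polynomials on functions on the lattice\<close>

abbreviation "lookup \<equiv> Poly_Mapping.lookup"
abbreviation "keys \<equiv> Poly_Mapping.keys"

text \<open>Only \<open>p\<close> is finitely supported; \<open>f\<close> may be the indicator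
  function of an unbounded cone.\<close>

definition convolve :: "('g \<Rightarrow>\<^sub>0 'k) \<Rightarrow> ('g::ab_group_add \<Rightarrow> 'k) \<Rightarrow> 'g \<Rightarrow> 'k::comm_ring_1" where
  "convolve p f x = (\<Sum>y\<in>keys p. lookup p y * f (x - y))"

text \<open>Cancellation can make the keys of a sum fewer than those of its summands, so additivity
  in \<open>p\<close> needs a common index set.\<close>

lemma convolve_superset:
  assumes "finite A" "keys p \<subseteq> A"
  shows "convolve p f x = (\<Sum>y\<in>A. lookup p y * f (x - y))"
  unfolding convolve_def using assms
  by (intro sum.mono_neutral_left) (auto simp: in_keys_iff)

lemma convolve_add_left: "convolve (p + q) f x = convolve p f x + convolve q f x"
  by (subst (1 2 3) convolve_superset[of "keys p \<union> keys q"])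
     (use keys_add[of p q] in \<open>auto simp: lookup_add distrib_right sum.distrib\<close>)

lemma convolve_diff_left: "convolve (p - q) f x = convolve p f x - convolve q f x"
  using convolve_add_left[of "p - q" q f x] by simp

lemma convolve_zero_left [simp]: "convolve 0 f x = 0"
  by (simp add: convolve_def)

lemma convolve_sum_left: "convolve (\<Sum>i\<in>I. p i) f x = (\<Sum>i\<in>I. convolve (p i) f x)"
  by (induction I rule: infinite_finite_induct) (simp_all add: convolve_add_left)

lemma convolve_single: "convolve (Poly_Mapping.single s c) f x = c * f (x - s)"
  by (simp add: convolve_def)

lemma convolve_binomial:
  "convolve (Poly_Mapping.single s 1 - Poly_Mapping.single r 1) f x = f (x - s) - f (x - r)"
  by (simp add: convolve_diff_left convolve_single)

lemma convolve_diff_right: "convolve p (\<lambda>y. f y - g y) x = convolve p f x - convolve p g x"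
  by (simp add: convolve_def right_diff_distrib sum_subtractf)

lemma convolve_sum_right: "convolve p (\<lambda>y. \<Sum>i\<in>I. f i y) x = (\<Sum>i\<in>I. convolve p (f i) x)"
  unfolding convolve_def sum_distrib_left by (rule sum.swap)

lemma poly_mapping_sum_single:
  "p = (\<Sum>s\<in>keys p. Poly_Mapping.single s (lookup p s))"
proof (rule poly_mapping_eqI)
  fix x
  have "lookup (\<Sum>s\<in>keys p. Poly_Mapping.single s (lookup p s)) x
      = (\<Sum>s\<in>keys p. if x = s then lookup p x else 0)"
    by (auto simp: lookup_sum lookup_single when_def intro!: sum.cong)
  also have "\<dots> = lookup p x"
    by (simp add: in_keys_iff)
  finally show "lookup p x = lookup (\<Sum>s\<in>keys p. Poly_Mapping.single s (lookup p s)) x" ..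
qed

text \<open>Both sides are bilinear in \<open>p\<close> and \<open>q\<close>, which reduces the
  claim to monomials, where it is the composition of two shifts. The factors of a product can thus
  act one at a time.\<close>

lemma convolve_mult: "convolve (p * q) f = convolve p (convolve q f)"
proof
  fix x
  have *: "convolve (Poly_Mapping.single s c * Poly_Mapping.single r d) f x
      = convolve (Poly_Mapping.single s c) (convolve (Poly_Mapping.single r d) f) x" for s c r d
    by (simp add: mult_single convolve_single algebra_simps)
  let ?m = "\<lambda>p s. Poly_Mapping.single s (lookup p s)"
  have "convolve (p * q) f x = convolve ((\<Sum>s\<in>keys p. ?m p s) * (\<Sum>r\<in>keys q. ?m q r)) f x"
    by (simp flip: poly_mapping_sum_single)
  also have "\<dots> = (\<Sum>s\<in>keys p. \<Sum>r\<in>keys q. convolve (?m p s) (convolve (?m q r) f) x)"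
    by (simp add: sum_product convolve_sum_left *)
  also have "\<dots> = (\<Sum>s\<in>keys p. convolve (?m p s) (convolve (\<Sum>r\<in>keys q. ?m q r) f) x)"
    by (simp only: convolve_sum_left[abs_def] flip: convolve_sum_right)
  also have "\<dots> = convolve (\<Sum>s\<in>keys p. ?m p s) (convolve (\<Sum>r\<in>keys q. ?m q r) f) x"
    by (simp add: convolve_sum_left)
  finally show "convolve (p * q) f x = convolve p (convolve q f) x"
    by (simp flip: poly_mapping_sum_single)
qed

lemma convolve_lookup_one: "convolve p (lookup 1) = lookup p"
  by (rule ext) (simp add: convolve_def lookup_one when_def in_keys_iff if_distrib cong: if_cong)

text \<open>\<open>lookup 1\<close> is the unit mass at 0, and \<open>lookup q\<close> arises from
  it by convolving with \<open>q\<close>. So the action extends ring multiplication.\<close>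

lemma convolve_lookup: "convolve p (lookup q) = lookup (p * q)"
  by (metis convolve_lookup_one convolve_mult)

section \<open>Half-lines, cones and their telescoping\<close>

text \<open>Both the indicator of \<open>n \<ge> 0\<close> and minus the indicator of \<open>n < 0\<close> satisfy this, so that
  flipping a ray of a cone does not change the convolution with the corresponding binomial.\<close>

definition half_line :: "(int \<Rightarrow> 'k::comm_ring_1) \<Rightarrow> bool" where
  "half_line h \<longleftrightarrow> (\<forall>n d. d \<ge> 0 \<longrightarrow> h n - h (n - d) = of_bool (0 \<le> n \<and> n < d))"

lemma half_line_nonneg: "half_line (\<lambda>n. of_bool (n \<ge> 0))"
  by (auto simp: half_line_def)

lemma half_line_neg: "half_line (\<lambda>n. of_bool (n \<ge> 0) - 1)"
  by (auto simp: half_line_def)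

text \<open>The three vertices off the origin are alike up to permuting coordinates. With
  \<open>i\<close> as the exponent of the distinguished variable, one cone computation serves all
  three.\<close>

locale exponent_coordinates =
  fixes \<mu> :: "int \<Rightarrow> int \<Rightarrow> int \<Rightarrow> 'g::ab_group_add"
  assumes add: "\<mu> i j l + \<mu> i' j' l' = \<mu> (i + i') (j + j') (l + l')"
    and eq_iff: "\<mu> i j l = \<mu> i' j' l' \<longleftrightarrow> i = i' \<and> j = j' \<and> l = l'"
    and surj: "\<exists>i j l. m = \<mu> i j l"
begin

lemma zero: "\<mu> 0 0 0 = 0"
  using add[of 0 0 0 0 0 0] by simp

lemma diff: "\<mu> i j l - \<mu> i' j' l' = \<mu> (i - i') (j - j') (l - l')"
  by (simp add: diff_eq_eq add)

definition monomial :: "int \<Rightarrow> int \<Rightarrow> int \<Rightarrow> ('g \<Rightarrow>\<^sub>0 'k::comm_ring_1)" where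
  "monomial i j l = Poly_Mapping.single (\<mu> i j l) 1"

lemma monomial_0: "monomial 0 0 0 = 1"
  by (simp add: monomial_def zero)

lemma monomial_mult: "monomial i j l * monomial i' j' l' = monomial (i + i') (j + j') (l + l')"
  by (simp add: monomial_def mult_single add)

lemma monomial_power: "monomial i j l ^ n = monomial (int n * i) (int n * j) (int n * l)"
  by (induction n) (simp_all add: monomial_0 monomial_mult algebra_simps)

lemma lookup_monomial:
  "lookup (monomial i' j' l') (\<mu> i j l) = of_bool (i = i' \<and> j = j' \<and> l = l')"
  by (auto simp: monomial_def lookup_single when_def eq_iff)

lemma convolve_monomial_diff:
  "convolve (monomial i' j' l' - monomial i'' j'' l'') f (\<mu> i j l)
     = f (\<mu> (i - i') (j - j') (l - l')) - f (\<mu> (i - i'') (j - j'') (l - l''))"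
  by (simp add: monomial_def convolve_binomial diff)

text \<open>Each pair of exponents \<open>j\<close>, \<open>l\<close> in the box belongs to exactly
  one term of the double sum, so every coefficient is 0 or 1. Over a common denominator the floor
  becomes an integer division.\<close>

lemma lookup_drc:
  fixes n i j l :: int
  shows "lookup (monomial n 0 0 * drc (monomial (-1) 0 0) (monomial 0 1 0) (monomial 0 0 1) a b c)
             (\<mu> i j l)
     = (of_bool (0 \<le> j \<and> j < int b \<and> 0 \<le> l \<and> l < int c \<and>
         i = n - (j * a * c + l * a * b) div (b * c)) :: 'k::comm_ring_1)"
proof -
  have fl: "\<lfloor>real (j * a) / real b + real (k * a) / real c\<rfloor>
      = (int j * a * c + int k * a * b) div (b * c)" if "j < b" "k < c" for j k
  proof -
    have "real (j * a) / real b + real (k * a) / real c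
        = real_of_int (int j * a * c + int k * a * b) / real_of_int (int b * int c)"
      using that by (simp add: field_simps)
    then show ?thesis
      by (simp only: floor_divide_of_int_eq of_nat_mult)
  qed
  have "lookup (monomial n 0 0 * drc (monomial (-1) 0 0) (monomial 0 1 0) (monomial 0 0 1) a b c)
             (\<mu> i j l)
     = (\<Sum>k'<c. \<Sum>j'<b. of_bool (i = n - (int j' * a * c + int k' * a * b) div (b * c)
           \<and> j = int j' \<and> l = int k') :: 'k)"
    unfolding drc_def sum_distrib_left lookup_sum
    by (intro sum.cong refl)
      (auto simp: fl[unfolded of_nat_mult] monomial_power monomial_mult lookup_monomial pos_imp_zdiv_nonneg_iff)
  \<comment> \<open>\<open>nat\<close> sends negative exponents to 0, so the sign conditions have to
    stay in the summand.\<close>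
  also have "\<dots> = (\<Sum>k'<c. \<Sum>j'<b. if k' = nat l \<and> j' = nat j then
      of_bool (0 \<le> j \<and> 0 \<le> l \<and> i = n - (j * a * c + l * a * b) div (b * c)) else 0)"
    by (intro sum.cong refl) auto
  also have "\<dots> = (\<Sum>k'<c. if k' = nat l then \<Sum>j'<b. if j' = nat j then
      of_bool (0 \<le> j \<and> 0 \<le> l \<and> i = n - (j * a * c + l * a * b) div (b * c)) else 0 else 0)"
    by (intro sum.cong refl) auto
  also have "\<dots> = of_bool (0 \<le> j \<and> j < int b \<and> 0 \<le> l \<and> l < int c \<and>
         i = n - (j * a * c + l * a * b) div (b * c))"
    by auto
  finally show ?thesis .
qed

text \<open>For fixed \<open>j\<close> and \<open>l\<close> the window of length
  \<open>b * c\<close> contains exactly one value of \<open>i\<close>. It is the one from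
  \<open>drc\<close> except at \<open>j = l = 0\<close>, where the window, open below and closed
  above, selects \<open>n + 1\<close> instead of \<open>n\<close>; the summand
  \<open>monomial 1 0 0 - 1\<close> makes this correction.\<close>

lemma lookup_vertex_term:
  fixes a b c :: nat and n i j l :: int
  assumes "a > 0" "b > 0" "c > 0" "coprime a b" "coprime a c" "coprime b c"
  shows "lookup (monomial n 0 0 * ((monomial 1 0 0 - 1)
            + drc (monomial (-1) 0 0) (monomial 0 1 0) (monomial 0 0 1) a b c)) (\<mu> i j l)
     = (of_bool (0 \<le> j \<and> j < int b \<and> 0 \<le> l \<and> l < int c \<and>
          0 < b * c * (i - n) + a * c * j + a * b * l \<and>
          b * c * (i - n) + a * c * j + a * b * l \<le> b * c) :: 'k::comm_ring_1)"
proof -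
  define q where "q = j * a * c + l * a * b"
  define B where "B = int b * int c"
  have B: "B > 0" using assms by (simp add: B_def)
  have "lookup (monomial n 0 0 * ((monomial 1 0 0 - 1)
            + drc (monomial (-1) 0 0) (monomial 0 1 0) (monomial 0 0 1) a b c)) (\<mu> i j l)
     = of_bool (i = n + 1 \<and> j = 0 \<and> l = 0) - of_bool (i = n \<and> j = 0 \<and> l = 0)
       + (of_bool (0 \<le> j \<and> j < int b \<and> 0 \<le> l \<and> l < int c \<and> i = n - q div B) :: 'k)"
    unfolding distrib_left right_diff_distrib lookup_add lookup_minus lookup_drc q_def B_def
    by (simp add: monomial_mult lookup_monomial)
  also have "\<dots> = of_bool (0 \<le> j \<and> j < int b \<and> 0 \<le> l \<and> l < int c \<and>
      0 < B * (i - n) + q \<and> B * (i - n) + q \<le> B)"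
  proof (cases "0 \<le> j \<and> j < int b \<and> 0 \<le> l \<and> l < int c")
    case range: True
    show ?thesis
    proof (cases "j = 0 \<and> l = 0")
      case True
      have "0 < B * (i - n) \<and> B * (i - n) \<le> B \<longleftrightarrow> i = n + 1"
        using B by (auto simp: zero_less_mult_iff mult_le_cancel_left1)
      then show ?thesis
        using True range by (auto simp: q_def)
    next
      case False
      \<comment> \<open>By coprimality, divisibility would force \<open>b\<close> to divide
        \<open>j\<close> and \<open>c\<close> to divide \<open>l\<close>, hence both to vanish in
        the given range.\<close>
      have "\<not> B dvd q"
      proof
        assume "B dvd q"
        then have "int b dvd j * a * c + l * a * b" "int c dvd j * a * c + l * a * b"
          unfolding B_def q_def by (fact dvd_mult_left, fact dvd_mult_right)
        then have "int b dvd j * a * c" "int c dvd l * a * b"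
          by (metis dvd_add_left_iff dvd_triv_right, metis dvd_add_right_iff dvd_triv_right)
        then have "int b dvd j" "int c dvd l"
          using assms(4-6) by (simp_all add: coprime_dvd_mult_left_iff coprime_commute)
        then show False
          using False range by (metis zdvd_not_zless order_le_less)
      qed
      then have r: "0 < q mod B" "q mod B < B"
        using B by (simp_all add: dvd_eq_mod_eq_0 order_le_neq_trans)
      have "B * (i - n) + q = B * (i - n + q div B) + q mod B"
        by (simp add: distrib_left add.assoc)
      moreover have "0 < B * x + q mod B \<and> B * x + q mod B \<le> B \<longleftrightarrow> x = 0" for x
      proof
        assume *: "0 < B * x + q mod B \<and> B * x + q mod B \<le> B"
        have "B * x < B * 1" "B * (-1) < B * x"
          using * r by linarith+
        then show "x = 0"
          using B unfolding mult_less_cancel_left_pos[OF B] by linarith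
      qed (use r in auto)
      ultimately have "0 < B * (i - n) + q \<and> B * (i - n) + q \<le> B \<longleftrightarrow> i - n + q div B = 0"
        by presburger
      then show ?thesis
        using False range by (auto simp: algebra_simps)
    qed
  qed (use assms in auto)
  finally show ?thesis
    by (simp add: q_def B_def algebra_simps)
qed

text \<open>Each binomial truncates one ray. \<open>X - 1\<close> cuts the half-space to a slab. In
  \<open>X ^ a - Y ^ b\<close> and \<open>X ^ a - Z ^ c\<close> both monomials lower the linear form
  by the same \<open>a * b * c\<close>, so the slab condition factors out and only a difference of
  \<open>h1\<close> or \<open>h2\<close> remains.\<close>

lemma convolve_cone:
  fixes a b c t :: nat and X Y Z X_inv :: "'g \<Rightarrow>\<^sub>0 'k::comm_ring_1"
  assumes pos: "a > 0" "b > 0" "c > 0" "coprime a b" "coprime a c" "coprime b c"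
    and h: "half_line h1" "half_line h2"
    and K: "\<And>(i::int) (j::int) (l::int). K (\<mu> i j l) = h1 j * h2 l * of_bool (b * c * i + a * c * j + a * b * l > a * b * c * t)"
    and XYZ: "X = monomial 1 0 0" "Y = monomial 0 1 0" "Z = monomial 0 0 1" "X_inv = monomial (-1) 0 0"
  shows "convolve ((X - 1) * (X ^ a - Y ^ b) * (X ^ a - Z ^ c)) K
     = lookup (- (X ^ ((t + 2) * a) * ((X - 1) + drc X_inv Y Z a b c)))"
proof
  fix m
  obtain i j l where m: "m = \<mu> i j l"
    using surj by blast
  define L where "L i j l = int b * c * i + int a * c * j + int a * b * l - int a * b * c * t" for i j l :: int
  have h1: "h1 n = h1 (n - d) + of_bool (0 \<le> n \<and> n < d)" if "d \<ge> 0" for n d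
    using h(1) that unfolding half_line_def by (metis add.commute diff_add_cancel)
  have h2: "h2 n = h2 (n - d) + of_bool (0 \<le> n \<and> n < d)" if "d \<ge> 0" for n d
    using h(2) that unfolding half_line_def by (metis add.commute diff_add_cancel)
  have K': "K (\<mu> i j l) = h1 j * h2 l * of_bool (L i j l > 0)" for i j l
    by (simp add: K L_def)
  have bc: "int b * c > 0" using pos by simp
  have L1: "L (i - 1) j l = L i j l - b * c" for i j l :: int
    by (simp add: L_def algebra_simps)
  have La: "L (i - a) j l = L i j l - a * b * c" for i j l :: int
    by (simp add: L_def algebra_simps)
  have Lb: "L i (j - b) l = L i j l - a * b * c" for i j l :: int
    by (simp add: L_def algebra_simps)
  have Lc: "L i j (l - c) = L i j l - a * b * c" for i j l :: int
    by (simp add: L_def algebra_simps)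
  define K1 where "K1 = convolve (X - 1) K"
  have K1: "K1 (\<mu> i j l) = - (h1 j * h2 l * of_bool (0 < L i j l \<and> L i j l \<le> int b * c))" for i j l
    using bc unfolding K1_def XYZ monomial_0[symmetric] convolve_monomial_diff
    by (auto simp: K' L1)
  define K2 where "K2 = convolve (X ^ a - Z ^ c) K1"
  have K2: "K2 (\<mu> i j l) = - (h1 j * of_bool (0 \<le> l \<and> l < int c \<and>
      0 < L i j l - a * b * c \<and> L i j l - a * b * c \<le> int b * c))" for i j l
    unfolding K2_def XYZ monomial_power convolve_monomial_diff
    by (auto simp: K1 La Lc h2[of "int c" l] distrib_left)
  define K3 where "K3 = convolve (X ^ a - Y ^ b) K2"
  have K3: "K3 (\<mu> i j l) = - of_bool (0 \<le> j \<and> j < int b \<and> 0 \<le> l \<and> l < int c \<and>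
      0 < L i j l - 2 * (a * b * c) \<and> L i j l - 2 * (a * b * c) \<le> int b * c)" for i j l
    unfolding K3_def XYZ monomial_power convolve_monomial_diff
    by (auto simp: K2 La Lb h1[of "int b" j] distrib_left)
  have "convolve ((X - 1) * (X ^ a - Y ^ b) * (X ^ a - Z ^ c)) K m = K3 m"
    by (simp only: K1_def K2_def K3_def mult_ac flip: convolve_mult)
  \<comment> \<open>The two shifts by \<open>a * b * c\<close> move the vertex from
    \<open>t * a\<close> to \<open>(t + 2) * a\<close>.\<close>
  also have "L i j l - 2 * (a * b * c)
      = int b * c * (i - int ((t + 2) * a)) + int a * c * j + int a * b * l"
    by (simp add: L_def algebra_simps)
  with K3 have "K3 m = lookup (- (X ^ ((t + 2) * a) * ((X - 1) + drc X_inv Y Z a b c))) m"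
    by (simp add: m XYZ monomial_power lookup_vertex_term[OF pos])
  finally show "convolve ((X - 1) * (X ^ a - Y ^ b) * (X ^ a - Z ^ c)) K m
     = lookup (- (X ^ ((t + 2) * a) * ((X - 1) + drc X_inv Y Z a b c))) m" .
qed

text \<open>Three geometric series: each factor turns the indicator of the nonnegative integers into
  minus that of 0.\<close>

lemma convolve_orthant:
  fixes K :: "'g \<Rightarrow> 'k::comm_ring_1"
  assumes K: "\<And>i j l. K (\<mu> i j l) = of_bool (i \<ge> 0) * of_bool (j \<ge> 0) * of_bool (l \<ge> 0)"
  shows "convolve ((monomial 1 0 0 - 1) * (monomial 0 1 0 - 1) * (monomial 0 0 1 - 1)) K = lookup (- 1)"
proof
  fix m
  obtain i j l where m: "m = \<mu> i j l"
    using surj by blast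
  show "convolve ((monomial 1 0 0 - 1) * (monomial 0 1 0 - 1) * (monomial 0 0 1 - 1)) K m = lookup (- 1) m"
    unfolding m convolve_mult monomial_0[symmetric] convolve_monomial_diff lookup_uminus lookup_monomial
    by (auto simp: K)
qed

end

section \<open>Lattice points of the dilated tetrahedron\<close>

lemma corner_tetrahedron_eq:
  assumes "a > 0" "b > 0" "c > 0"
  shows "corner_tetrahedron a b c
    = {x. 0 \<le> x $ 1 \<and> 0 \<le> x $ 2 \<and> 0 \<le> x $ 3 \<and> x $ 1 / a + x $ 2 / b + x $ 3 / c \<le> 1}"
    (is "_ = ?T")
proof
  have "convex ?T"
  proof (rule convexI)
    fix x y :: "real ^ 3" and p q :: real
    assume x: "x \<in> ?T" and y: "y \<in> ?T" and pq: "0 \<le> p" "0 \<le> q" "p + q = 1"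
    have "p * (x $ 1 / a + x $ 2 / b + x $ 3 / c) + q * (y $ 1 / a + y $ 2 / b + y $ 3 / c) \<le> 1"
      using x y pq by (intro convex_bound_le) auto
    then show "p *\<^sub>R x + q *\<^sub>R y \<in> ?T"
      using x y pq by (auto simp: algebra_simps add_divide_distrib)
  qed
  then show "corner_tetrahedron a b c \<subseteq> ?T"
    unfolding corner_tetrahedron_def using assms
    by (intro hull_minimal) (auto simp: vector_3)
next
  show "?T \<subseteq> corner_tetrahedron a b c"
  proof
    fix x assume x: "x \<in> ?T"
    let ?V = "{vector [real a, 0, 0], vector [0, real b, 0], vector [0, 0, real c], 0} :: (real ^ 3) set"
    \<comment> \<open>Barycentric coordinates; the slack in the inequality is the weight of the
      origin.\<close>
    define p where "p = (!) [x $ 1 / a, x $ 2 / b, x $ 3 / c, 1 - (x $ 1 / a + x $ 2 / b + x $ 3 / c)]"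
    define V where "V = (!) [vector [real a, 0, 0], vector [0, real b, 0], vector [0, 0, real c], 0 :: real ^ 3]"
    have all: "P 0 \<Longrightarrow> P 1 \<Longrightarrow> P 2 \<Longrightarrow> P 3 \<Longrightarrow> i \<in> {..<4} \<Longrightarrow> P i" for P and i :: nat
      by (auto simp: less_Suc_eq numeral_eq_Suc)
    have "(\<Sum>i<4. p i *\<^sub>R V i) \<in> convex hull ?V"
    proof (rule convex_sum)
      show "0 \<le> p i" if "i \<in> {..<4}" for i
        by (rule all[OF _ _ _ _ that]) (use x in \<open>auto simp: p_def\<close>)
      show "V i \<in> convex hull ?V" if "i \<in> {..<4}" for i
        by (rule all[OF _ _ _ _ that]) (auto simp: V_def intro: hull_inc)
    qed (auto simp: p_def numeral_eq_Suc)
    also have "(\<Sum>i<4. p i *\<^sub>R V i) = x"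
      using assms by (simp add: p_def V_def numeral_eq_Suc vec_eq_iff forall_3 vector_3)
    finally show "x \<in> corner_tetrahedron a b c"
      by (simp add: corner_tetrahedron_def)
  qed
qed

text \<open>Clearing denominators yields the integer inequality complementary to the one in
  \<open>convolve_cone\<close>.\<close>

lemma lattice_points_dilated_corner_tetrahedron:
  fixes i j l :: int
  assumes "a > 0" "b > 0" "c > 0" "t > 0"
  shows "(i, j, l) \<in> lattice_points ((\<lambda>x. real t *\<^sub>R x) ` corner_tetrahedron a b c) \<longleftrightarrow>
    0 \<le> i \<and> 0 \<le> j \<and> 0 \<le> l \<and> b * c * i + a * c * j + a * b * l \<le> a * b * c * t"
proof -
  have "(i, j, l) \<in> lattice_points ((\<lambda>x. real t *\<^sub>R x) ` corner_tetrahedron a b c) \<longleftrightarrow>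
      (1 / real t) *\<^sub>R vector [real_of_int i, real_of_int j, real_of_int l] \<in> corner_tetrahedron a b c"
    using assms(4) by (force simp: lattice_points_def image_iff)
  also have "\<dots> \<longleftrightarrow> 0 \<le> i \<and> 0 \<le> j \<and> 0 \<le> l \<and> i / t / a + j / t / b + l / t / c \<le> 1"
    using assms by (simp add: corner_tetrahedron_eq vector_3 zero_le_divide_iff)
  also have "i / t / a + j / t / b + l / t / c
      = real_of_int (b * c * i + a * c * j + a * b * l) / real_of_int (a * b * c * t)"
    using assms by (simp add: field_simps)
  also have "\<dots> \<le> 1 \<longleftrightarrow> b * c * i + a * c * j + a * b * l \<le> int (a * b * c * t)"
    using assms by (subst divide_le_eq_1_pos) (simp_all only: of_int_le_iff, simp_all)
  finally show ?thesis
    by simp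
qed

lemma lookup_integer_point_transform:
  assumes "bounded P"
  shows "lookup (integer_point_transform P :: 'k::comm_ring_1 laurent3) m = of_bool (m \<in> lattice_points P)"
proof -
  have "lookup (integer_point_transform P :: 'k laurent3) m = (\<Sum>m'\<in>lattice_points P. if m' = m then 1 else 0)"
    by (auto simp: integer_point_transform_def lookup_sum laurent_monomial_def lookup_single
        when_def intro!: sum.cong)
  then show ?thesis
    using finite_lattice_points[OF assms] by simp
qed

section \<open>Cone decomposition and the identity\<close>

theorem theorem14:
  fixes a b c t :: nat
    and u v w u_inv v_inv w_inv :: "'k::comm_ring_1 laurent3"
  assumes "a > 0" "b > 0" "c > 0" "t > 0"
    and "coprime a b" "coprime a c" "coprime b c"
    and "u = laurent_monomial 1 0 0" "v = laurent_monomial 0 1 0" "w = laurent_monomial 0 0 1"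
    and "u_inv = laurent_monomial (-1) 0 0" "v_inv = laurent_monomial 0 (-1) 0"
      "w_inv = laurent_monomial 0 0 (-1)"
  shows
    "(u - 1) * (v - 1) * (w - 1) * (u ^ a - v ^ b) * (u ^ a - w ^ c) * (v ^ b - w ^ c)
       * integer_point_transform ((\<lambda>x. real t *\<^sub>R x) ` corner_tetrahedron a b c)
     = u ^ ((t + 2) * a) * (v - 1) * (w - 1) * (v ^ b - w ^ c) * ((u - 1) + drc u_inv v w a b c)
       - v ^ ((t + 2) * b) * (u - 1) * (w - 1) * (u ^ a - w ^ c) * ((v - 1) + drc v_inv u w b a c)
       + w ^ ((t + 2) * c) * (u - 1) * (v - 1) * (u ^ a - v ^ b) * ((w - 1) + drc w_inv u v c a b)
       - (u ^ a - v ^ b) * (u ^ a - w ^ c) * (v ^ b - w ^ c)"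
proof -
  \<comment> \<open>The distinguished exponent is that of \<open>u\<close>, \<open>v\<close>,
    \<open>w\<close> in turn; the other two follow in the argument order of
    \<open>drc\<close>.\<close>
  interpret A: exponent_coordinates "\<lambda>i j l. (i, j, l)"
    by unfold_locales auto
  interpret B: exponent_coordinates "\<lambda>i j l. (j, i, l)"
    by unfold_locales auto
  interpret C: exponent_coordinates "\<lambda>i j l. (j, l, i)"
    by unfold_locales auto
  let ?P = "(\<lambda>x. real t *\<^sub>R x) ` corner_tetrahedron a b c"
  define pos neg :: "int \<Rightarrow> 'k" where "pos = (\<lambda>n. of_bool (n \<ge> 0))" and "neg = (\<lambda>n. of_bool (n \<ge> 0) - 1)"
  have half_line: "half_line pos" "half_line neg"
    by (simp_all add: pos_def neg_def half_line_nonneg half_line_neg)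
  define beyond :: "int \<Rightarrow> int \<Rightarrow> int \<Rightarrow> 'k"
    where "beyond = (\<lambda>(i::int) (j::int) (l::int). of_bool (b * c * i + a * c * j + a * b * l > a * b * c * t))"
  text \<open>The orthant at the origin and the flipped cones at the three other vertices; using \<open>neg\<close> for
    the flipped rays absorbs their signs.\<close>
  define K0 where "K0 = (\<lambda>(i, j, l). pos i * pos j * pos l)"
  define KA where "KA = (\<lambda>(i, j, l). pos j * pos l * beyond i j l)"
  define KB where "KB = (\<lambda>(i, j, l). neg i * pos l * beyond i j l)"
  define KC where "KC = (\<lambda>(i, j, l). neg i * neg j * beyond i j l)"

  define FA where "FA = u ^ ((t + 2) * a) * ((u - 1) + drc u_inv v w a b c)"
  define FB where "FB = v ^ ((t + 2) * b) * ((v - 1) + drc v_inv u w b a c)"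
  define FC where "FC = w ^ ((t + 2) * c) * ((w - 1) + drc w_inv u v c a b)"
  have K0: "convolve ((u - 1) * (v - 1) * (w - 1)) K0 = lookup (- 1)"
    unfolding assms laurent_monomial_def A.monomial_def[symmetric]
    by (rule A.convolve_orthant) (simp add: K0_def pos_def)
  have KA: "convolve ((u - 1) * (u ^ a - v ^ b) * (u ^ a - w ^ c)) KA = lookup (- FA)"
    unfolding FA_def
    by (rule A.convolve_cone[OF _ _ _ _ _ _ half_line(1) half_line(1)])
       (use assms in \<open>auto simp: KA_def beyond_def A.monomial_def laurent_monomial_def\<close>)
  have KB: "convolve ((v - 1) * (v ^ b - u ^ a) * (v ^ b - w ^ c)) KB = lookup (- FB)"
    unfolding FB_def
    by (rule B.convolve_cone[OF _ _ _ _ _ _ half_line(2) half_line(1)])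
       (use assms in \<open>auto simp: KB_def beyond_def B.monomial_def laurent_monomial_def
          coprime_commute algebra_simps\<close>)
  have KC: "convolve ((w - 1) * (w ^ c - u ^ a) * (w ^ c - v ^ b)) KC = lookup (- FC)"
    unfolding FC_def
    by (rule C.convolve_cone[OF _ _ _ _ _ _ half_line(2) half_line(2)])
       (use assms in \<open>auto simp: KC_def beyond_def C.monomial_def laurent_monomial_def
          coprime_commute algebra_simps\<close>)

  have "bounded ?P"
    unfolding corner_tetrahedron_def by (intro bounded_scaling finite_imp_bounded_convex_hull) auto
  have decomposition: "lookup (integer_point_transform ?P) = (\<lambda>m. K0 m - KA m - KB m - KC m)"
  proof
    fix m :: "int \<times> int \<times> int"
    obtain i j l where m: "m = (i, j, l)"
      by (cases m)
    \<comment> \<open>Replacing \<open>pos\<close> by \<open>1 + neg\<close> one coordinate at a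
      time expands \<open>pos i * pos j * pos l\<close> into \<open>pos j * pos l + neg i * pos l +
      neg i * neg j + neg i * neg j * neg l\<close>. Multiplied by \<open>beyond\<close>, the first
      three terms are the cones, and the last one vanishes by this fact.\<close>
    have "\<not> a * b * c * t < b * c * i + a * c * j + a * b * l" if "i < 0" "j < 0" "l < 0"
    proof -
      have "int (b * c) * i \<le> 0" "int (a * c) * j \<le> 0" "int (a * b) * l \<le> 0"
        using that by (simp_all only: mult_nonneg_nonpos of_nat_0_le_iff order.strict_implies_order)
      moreover have "int (a * b * c * t) \<ge> 0"
        by simp
      ultimately show ?thesis
        by linarith
    qed
    then show "lookup (integer_point_transform ?P) m = K0 m - KA m - KB m - KC m"
      unfolding lookup_integer_point_transform[OF \<open>bounded ?P\<close>] m
        lattice_points_dilated_corner_tetrahedron[OF assms(1-4)] K0_def KA_def KB_def KC_def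
        pos_def neg_def beyond_def
      by (cases "i \<ge> 0"; cases "j \<ge> 0"; cases "l \<ge> 0") auto
  qed

  define D where "D = (u - 1) * (v - 1) * (w - 1) * (u ^ a - v ^ b) * (u ^ a - w ^ c) * (v ^ b - w ^ c)"
  \<comment> \<open>The cofactors in \<open>D\<close> of the binomials of each cone.
    \<open>RB\<close> carries a sign because one binomial of \<open>KB\<close> is reversed; the two
    reversals for \<open>KC\<close> cancel.\<close>
  define R0 RA RB RC where "R0 = (u ^ a - v ^ b) * (u ^ a - w ^ c) * (v ^ b - w ^ c)"
    and "RA = (v - 1) * (w - 1) * (v ^ b - w ^ c)"
    and "RB = - ((u - 1) * (w - 1) * (u ^ a - w ^ c))"
    and "RC = (u - 1) * (v - 1) * (u ^ a - v ^ b)"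
  have flip: "v ^ b - u ^ a = - (u ^ a - v ^ b)" "w ^ c - u ^ a = - (u ^ a - w ^ c)"
    "w ^ c - v ^ b = - (v ^ b - w ^ c)"
    by simp_all
  have D: "D = R0 * ((u - 1) * (v - 1) * (w - 1))"
    "D = RA * ((u - 1) * (u ^ a - v ^ b) * (u ^ a - w ^ c))"
    "D = RB * ((v - 1) * (v ^ b - u ^ a) * (v ^ b - w ^ c))"
    "D = RC * ((w - 1) * (w ^ c - u ^ a) * (w ^ c - v ^ b))"
    unfolding D_def R0_def RA_def RB_def RC_def flip by (simp_all only: mult_ac minus_mult_minus
        mult_minus_left mult_minus_right minus_minus)
  \<comment> \<open>Once \<open>q\<close> has made a cone finitely supported, the cofactor acts by
    ring multiplication.\<close>
  have multiple: "convolve (p * q) f = lookup (p * g)" if "convolve q f = lookup g"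
    for p q g :: "'k laurent3" and f
    using that by (simp add: convolve_mult convolve_lookup)
  have "convolve D K0 = lookup (R0 * - 1)" "convolve D KA = lookup (RA * - FA)"
    "convolve D KB = lookup (RB * - FB)" "convolve D KC = lookup (RC * - FC)"
    using multiple[OF K0, of R0] multiple[OF KA, of RA] multiple[OF KB, of RB] multiple[OF KC, of RC]
    unfolding D[symmetric] by simp_all
  then have "D * integer_point_transform ?P = R0 * - 1 - RA * - FA - RB * - FB - RC * - FC"
    by (intro poly_mapping_eqI)
       (simp only: convolve_lookup[symmetric] decomposition convolve_diff_right lookup_minus)
  then show ?thesis
    unfolding D_def R0_def RA_def RB_def RC_def FA_def FB_def FC_def
    by (simp add: mult_ac)
qed

end
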